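(* Let $F$ be a subexponential distribution on $\mathbb{R}$. Suppose that $G_1,\dots,G_n$ are distributions on $\mathbb{R}$ such that, for each $k=1,\dots,n$, the measure $F+G_k$ is long-tailed and $\overline{G_k}(x)=O(\overline{F}(x))$ as $x\to\infty$. Then $$\overline{G_1*\dots*G_n}(x)=\sum_{i=1}^n\overline{G_i}(x)+o(\overline{F}(x))\quad\text{as }x\to\infty.$$
   Context: A distribution is a (Borel) probability measure on $\mathbb{R}$. For a finite Borel measure $F$ on $\mathbb{R}$ the tail function is $\overline{F}(x)=F((x,\infty))$; $F*G$ denotes convolution. A finite measure $F$ on $\mathbb{R}$ is long-tailed if $\overline{F}(x)>0$ for all $x$ and, for every constant $a\in\mathbb{R}$, $\overline{F}(x+a)/\overline{F}(x)\to 1$ as $x\to\infty$. A distribution $F$ on $\mathbb{R}$ is subexponential if it is long-tailed and $\overline{F*F}(x)=2\overline{F}(x)+o(\overline{F}(x))$ as $x\to\infty$. *)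

theory Defs
  imports "HOL-Probability.Probability" "HOL-Library.Landau_Symbols"
begin

definition tail :: "real measure \<Rightarrow> real \<Rightarrow> real" where
  "tail F x = measure F {x<..}"

text \<open>The setwise sum of two measures on the same measurable space, which the library does not
  provide (\<open>sup\<close> on measures is the lattice supremum).\<close>

definition add_measure :: "'a measure \<Rightarrow> 'a measure \<Rightarrow> 'a measure" where
  "add_measure M N = measure_of (space M) (sets M) (\<lambda>A. emeasure M A + emeasure N A)"

lemma space_add_measure [simp]: "space (add_measure M N) = space M"
  and sets_add_measure [simp, measurable_cong]: "sets (add_measure M N) = sets M"
  by (simp_all add: add_measure_def)

lemma emeasure_add_measure:
  assumes "sets M = sets N" "A \<in> sets M"
  shows "emeasure (add_measure M N) A = emeasure M A + emeasure N A"
  unfolding add_measure_def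
proof (rule emeasure_measure_of_sigma)
  show "sigma_algebra (space M) (sets M)" by (rule sets.sigma_algebra_axioms)
  show "positive (sets M) (\<lambda>A. emeasure M A + emeasure N A)" by (simp add: positive_def)
  show "countably_additive (sets M) (\<lambda>A. emeasure M A + emeasure N A)"
  proof (rule countably_additiveI)
    fix B :: "nat \<Rightarrow> 'a set"
    assume *: "range B \<subseteq> sets M" "disjoint_family B"
    then show "(\<Sum>i. emeasure M (B i) + emeasure N (B i)) = emeasure M (\<Union>i. B i) + emeasure N (\<Union>i. B i)"
      using assms(1) by (subst suminf_add[symmetric]) (simp_all add: suminf_emeasure)
  qed
qed fact

lemma finite_borel_measure_add_measure:
  assumes "finite_borel_measure M" "finite_borel_measure N"
  shows "finite_borel_measure (add_measure M N)"
proof -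
  interpret M: finite_borel_measure M by fact
  interpret N: finite_borel_measure N by fact
  have sets: "sets M = sets N" by (simp add: M.M_is_borel N.M_is_borel)
  have "emeasure (add_measure M N) (space M) = emeasure M (space M) + emeasure N (space N)"
    unfolding sets_eq_imp_space_eq[OF sets, symmetric]
    by (rule emeasure_add_measure[OF sets sets.top])
  then have "finite_measure (add_measure M N)"
    by (intro finite_measureI) simp
  then show ?thesis
    by (simp add: finite_borel_measure_def finite_borel_measure_axioms_def M.M_is_borel)
qed

lemma tail_add_measure:
  assumes "finite_borel_measure M" "finite_borel_measure N"
  shows "tail (add_measure M N) x = tail M x + tail N x"
proof -
  interpret M: finite_borel_measure M by fact
  interpret N: finite_borel_measure N by fact
  have "sets M = sets N" by (simp add: M.M_is_borel N.M_is_borel)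
  moreover have "{x<..} \<in> sets M" by (simp add: M.M_is_borel)
  ultimately show ?thesis
    by (simp add: tail_def measure_def emeasure_add_measure enn2real_plus less_top[symmetric])
qed

definition long_tailed :: "real measure \<Rightarrow> bool" where
  "long_tailed F \<longleftrightarrow> finite_borel_measure F \<and> (\<forall>x. tail F x > 0) \<and>
     (\<forall>a. ((\<lambda>x. tail F (x + a) / tail F x) \<longlongrightarrow> 1) at_top)"

definition subexponential :: "real measure \<Rightarrow> bool" where
  "subexponential F \<longleftrightarrow> real_distribution F \<and> long_tailed F \<and>
     (\<lambda>x. tail (F \<star> F) x - 2 * tail F x) \<in> o[at_top](tail F)"

text \<open>\<open>convolutions G n\<close> is $G_1 * \dots * G_n$; the empty convolution is the unit mass at \<open>0\<close>.\<close>

primrec convolutions :: "(nat \<Rightarrow> real measure) \<Rightarrow> nat \<Rightarrow> real measure" where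
  "convolutions G 0 = return borel 0"
| "convolutions G (Suc n) = (convolutions G n \<star> G (Suc n))"

lemma convolutions_1:
  assumes "finite_borel_measure (G 1)"
  shows "convolutions G 1 = G 1"
proof (rule measure_eqI)
  interpret finite_borel_measure "G 1" by fact
  show "sets (convolutions G 1) = sets (G 1)" by (simp add: M_is_borel[simplified])
  fix A assume "A \<in> sets (convolutions G 1)"
  then have [measurable]: "A \<in> sets borel" by simp
  have fin: "finite_measure (return borel (0::real))"
    by (simp add: prob_space.finite_measure prob_space_return)
  have [measurable_cong]: "sets (G (Suc 0)) = sets borel" using M_is_borel by simp
  have fin1: "finite_measure (G (Suc 0))" using finite_measure_axioms by simp
  interpret G: sigma_finite_measure "G (Suc 0)" using sigma_finite_measure_axioms by simp
  show "emeasure (convolutions G 1) A = emeasure (G 1) A"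
    by (simp add: convolution_emeasure' fin fin1 M_is_borel[simplified] nn_integral_return)
qed

end

theory Submission
  imports Defs
begin

text \<open>
  A sum of two independent variables \<open>X\<close> and \<open>Y\<close>, with distributions \<open>A\<close> and \<open>B\<close>, exceeds a
  large \<open>x\<close> either because exactly one summand is large or because both are. Fix a level \<open>h\<close> with
  \<open>2 * h \<le> x\<close>. Then \<open>X + Y > x\<close> is the disjoint union of the events in which moreover
  \<open>X \<le> h\<close>, or \<open>Y \<le> h\<close>, or \<open>X > h\<close> and \<open>Y > h\<close> (\<open>tail_convolution_split\<close>).

  Since \<open>\<bar>X\<bar> \<le> h\<close> with probability close to \<open>1\<close> for large \<open>h\<close>, the first probability lies
  between almost \<open>tail B (x + h)\<close> and \<open>tail B (x - h)\<close>. When bounded shifts change the tail of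
  \<open>B\<close> by only \<open>o(tail F)\<close>, it equals \<open>tail B x\<close> up to a small multiple of \<open>tail F x\<close>
  (\<open>small_first_asymp\<close>); the second event gives \<open>tail A x\<close> in the same way.

  The third event is where subexponentiality enters. Its probability grows by at most a constant
  factor when a summand is replaced by one with distribution \<open>F\<close>, because beyond the level \<open>h\<close> the
  tails of \<open>A\<close> and \<open>B\<close> are at most constant multiples of that of \<open>F\<close> (\<open>joint_excess_mono\<close>). For
  two copies of \<open>F\<close> the first two events already account for \<open>2 * tail F x\<close>, that is, for almost all
  of the tail of \<open>F \<star> F\<close>, and so the third is negligible (\<open>subexponential_joint_excess\<close>).

  Hence \<open>tail (A \<star> B) = tail A + tail B + o(tail F)\<close>. This asymptotic identity also shows that
  \<open>A \<star> B\<close> has again a tail of order \<open>O(tail F)\<close> that bounded shifts change by \<open>o(tail F)\<close>, so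
  convolution can be iterated.
\<close>

section \<open>Tails and their asymptotic classes\<close>

lemma tail_nonneg [simp]: "0 \<le> tail A x"
  by (simp add: tail_def)

lemma tail_antimono:
  assumes "real_distribution A" "x \<le> y"
  shows "tail A y \<le> tail A x"
proof -
  interpret A: real_distribution A by fact
  show ?thesis unfolding tail_def
    using assms(2) by (intro A.finite_measure_mono) auto
qed

lemma tail_eq_cdf:
  assumes "real_distribution A"
  shows "tail A x = 1 - cdf A x"
proof -
  interpret A: real_distribution A by fact
  have "measure A (space A - {..x}) = 1 - measure A {..x}"
    by (rule A.prob_compl) simp
  moreover have "space A - {..x} = {x<..}" by auto
  ultimately show ?thesis by (simp only: tail_def cdf_def)
qed

lemma measure_Ioc_eq_tail_diff:
  assumes "real_distribution A" "a \<le> b"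
  shows "measure A {a<..b} = tail A a - tail A b"
proof -
  interpret A: real_distribution A by fact
  have "{a<..b} = {a<..} - {b<..}" by auto
  then show ?thesis
    unfolding tail_def using assms(2) by (simp add: A.finite_measure_Diff)
qed

lemma measure_symmetric_Ioc_tendsto_1:
  assumes "real_distribution A"
  shows "((\<lambda>h. measure A {-h<..h}) \<longlongrightarrow> 1) at_top"
proof -
  interpret A: real_distribution A by fact
  have "((\<lambda>h. cdf A h - cdf A (-h)) \<longlongrightarrow> 1 - 0) at_top"
    by (intro tendsto_diff A.cdf_lim_at_top_prob
        filterlim_compose[OF A.cdf_lim_at_bot filterlim_uminus_at_bot_at_top])
  moreover have "\<forall>\<^sub>F h in at_top. cdf A h - cdf A (-h) = measure A {-h<..h}"
    using eventually_ge_at_top[of 0]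
    by eventually_elim (simp add: measure_Ioc_eq_tail_diff[OF assms] tail_eq_cdf[OF assms])
  ultimately show ?thesis
    by (simp add: Lim_transform_eventually)
qed

lemma real_distribution_convolution:
  assumes "real_distribution A" "real_distribution B"
  shows "real_distribution (A \<star> B)"
proof -
  interpret A: real_distribution A by fact
  interpret B: real_distribution B by fact
  interpret P: pair_prob_space A B ..
  show ?thesis
    unfolding convolution_def real_distribution_def real_distribution_axioms_def
    by (auto intro!: P.prob_space_distr)
qed

text \<open>The condition that \<open>add_measure F A\<close> is long-tailed says that bounded shifts change the sum of
  the two tails by a smaller order. Stated as below, for the tail of \<open>A\<close> alone and relative to \<open>F\<close>,
  the condition is linear in \<open>tail A\<close>, and this makes it stable under convolution. It allows \<open>A\<close>
  to have a tail far lighter than that of \<open>F\<close>, or even bounded support.\<close>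

definition tail_regular :: "real measure \<Rightarrow> real measure \<Rightarrow> bool" where
  "tail_regular F A \<longleftrightarrow> real_distribution A \<and> tail A \<in> O[at_top](tail F) \<and>
     (\<forall>a. (\<lambda>x. tail A (x + a) - tail A x) \<in> o[at_top](tail F))"

lemma long_tailed_increment:
  assumes "long_tailed F"
  shows "(\<lambda>x. tail F (x + a) - tail F x) \<in> o[at_top](tail F)"
proof (rule smalloI_tendsto)
  have pos: "tail F x > 0" for x using assms by (simp add: long_tailed_def)
  have "((\<lambda>x. tail F (x + a) / tail F x - 1) \<longlongrightarrow> 1 - 1) at_top"
    using assms by (intro tendsto_diff tendsto_const) (simp add: long_tailed_def)
  moreover have "tail F (x + a) / tail F x - 1 = (tail F (x + a) - tail F x) / tail F x" for x
    using pos[of x] by (simp add: field_simps)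
  ultimately show "((\<lambda>x. (tail F (x + a) - tail F x) / tail F x) \<longlongrightarrow> 0) at_top"
    by simp
  show "\<forall>\<^sub>F x in at_top. tail F x \<noteq> 0"
    using pos by (simp add: less_imp_neq[symmetric])
qed

lemma tail_regular_refl:
  assumes "real_distribution F" "long_tailed F"
  shows "tail_regular F F"
  using assms long_tailed_increment by (simp add: tail_regular_def)

text \<open>The increments of \<open>tail F + tail G\<close> and those of \<open>tail F\<close> are both \<open>o(tail F)\<close>, the former because
  the sum of the tails is \<open>O(tail F)\<close>; their difference is the increment of \<open>tail G\<close>.\<close>

lemma tail_regular_of_long_tailed_sum:
  assumes "real_distribution F" "long_tailed F" "real_distribution G"
    and "long_tailed (add_measure F G)" "tail G \<in> O[at_top](tail F)"
  shows "tail_regular F G"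
proof -
  interpret F: real_distribution F by fact
  interpret G: real_distribution G by fact
  have sum: "tail (add_measure F G) = (\<lambda>x. tail F x + tail G x)"
    using tail_add_measure[OF F.finite_borel_measure_M G.finite_borel_measure_M] by auto
  have big: "tail (add_measure F G) \<in> O[at_top](tail F)"
    unfolding sum using assms(5) by (intro sum_in_bigo) auto
  have "(\<lambda>x. tail G (x + a) - tail G x) \<in> o[at_top](tail F)" for a
  proof -
    have "(\<lambda>x. tail (add_measure F G) (x + a) - tail (add_measure F G) x) \<in> o[at_top](tail F)"
      using long_tailed_increment[OF assms(4)] big by (rule landau_o.small_big_trans)
    from sum_in_smallo(2)[OF this long_tailed_increment[OF assms(2), of a]]
    show ?thesis by (simp add: sum algebra_simps)
  qed
  then show ?thesis using assms by (simp add: tail_regular_def)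
qed

lemma tail_regular_eventually_small_window:
  assumes "tail_regular F A" "\<epsilon> > 0"
  shows "\<forall>\<^sub>F x in at_top. tail A (x - h) - tail A (x + h) \<le> \<epsilon> * tail F x"
proof -
  have "(\<lambda>x. tail A (x + a) - tail A x) \<in> o[at_top](tail F)" for a
    using assms(1) by (simp add: tail_regular_def)
  from sum_in_smallo(2)[OF this[of "-h"] this[of h]]
  have "(\<lambda>x. (tail A (x + (-h)) - tail A x) - (tail A (x + h) - tail A x)) \<in> o[at_top](tail F)" .
  from landau_o.smallD[OF this assms(2)] show ?thesis
    by eventually_elim auto
qed

section \<open>Splitting a convolution at a level\<close>

text \<open>For independent \<open>X\<close> and \<open>Y\<close> with distributions \<open>A\<close> and \<open>B\<close>, these are the parts into which the
  event \<open>X + Y > x\<close> is cut at the level \<open>h\<close>. Only one of the two parts with a small summand is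
  named; the other arises from it by exchanging \<open>A\<close> and \<open>B\<close>.\<close>

definition joint_excess :: "real \<Rightarrow> real measure \<Rightarrow> real measure \<Rightarrow> real \<Rightarrow> real" where
  "joint_excess h A B x = measure (A \<Otimes>\<^sub>M B) {(u, v). h < u \<and> h < v \<and> x < u + v}"

definition small_first :: "real \<Rightarrow> real measure \<Rightarrow> real measure \<Rightarrow> real \<Rightarrow> real" where
  "small_first h A B x = measure (A \<Otimes>\<^sub>M B) {(u, v). u \<le> h \<and> x < u + v}"

lemma sets_pair_real_distributions:
  assumes "real_distribution A" "real_distribution B"
  shows "sets (A \<Otimes>\<^sub>M B) = sets (borel \<Otimes>\<^sub>M borel)"
  using assms by (intro sets_pair_measure_cong) (auto simp: real_distribution.events_eq_borel)

lemma measure_pair_Times: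
  assumes "real_distribution A" "real_distribution B" "X \<in> sets borel" "Y \<in> sets borel"
  shows "measure (A \<Otimes>\<^sub>M B) (X \<times> Y) = measure A X * measure B Y"
proof -
  interpret A: real_distribution A by fact
  interpret B: real_distribution B by fact
  show ?thesis
    using assms by (simp add: measure_def B.emeasure_pair_measure_Times enn2real_mult)
qed

lemma joint_excess_event_sets:
  "{z::real \<times> real. h < fst z \<and> h < snd z \<and> x < fst z + snd z} \<in> sets (borel \<Otimes>\<^sub>M borel)"
proof -
  have "Measurable.pred (borel \<Otimes>\<^sub>M borel) (\<lambda>z::real \<times> real. h < fst z \<and> h < snd z \<and> x < fst z + snd z)"
    by measurable
  then show ?thesis by (simp add: pred_def space_pair_measure)
qed

lemma small_first_event_sets:
  "{z::real \<times> real. fst z \<le> h \<and> x < fst z + snd z} \<in> sets (borel \<Otimes>\<^sub>M borel)"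
proof -
  have "Measurable.pred (borel \<Otimes>\<^sub>M borel) (\<lambda>z::real \<times> real. fst z \<le> h \<and> x < fst z + snd z)"
    by measurable
  then show ?thesis by (simp add: pred_def space_pair_measure)
qed

lemma small_second_event_sets:
  "{z::real \<times> real. snd z \<le> h \<and> x < fst z + snd z} \<in> sets (borel \<Otimes>\<^sub>M borel)"
proof -
  have "Measurable.pred (borel \<Otimes>\<^sub>M borel) (\<lambda>z::real \<times> real. snd z \<le> h \<and> x < fst z + snd z)"
    by measurable
  then show ?thesis by (simp add: pred_def space_pair_measure)
qed

lemma measure_pair_swap:
  assumes "real_distribution A" "real_distribution B" "{z. P z} \<in> sets (borel \<Otimes>\<^sub>M borel)"
  shows "measure (A \<Otimes>\<^sub>M B) {z. P z} = measure (B \<Otimes>\<^sub>M A) {(v, u). P (u, v)}"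
proof -
  interpret A: real_distribution A by fact
  interpret B: real_distribution B by fact
  interpret P: pair_prob_space A B ..
  have sets: "{z. P z} \<in> sets (A \<Otimes>\<^sub>M B)"
    using assms(3) by (simp add: sets_pair_real_distributions[OF assms(1,2)])
  have "measure (A \<Otimes>\<^sub>M B) {z. P z} = measure (distr (B \<Otimes>\<^sub>M A) (A \<Otimes>\<^sub>M B) (\<lambda>(x, y). (y, x))) {z. P z}"
    by (subst P.distr_pair_swap) (rule refl)
  also have "\<dots> = measure (B \<Otimes>\<^sub>M A) {(v, u). P (u, v)}"
    by (subst measure_distr[OF _ sets])
      (auto intro!: arg_cong[where f = "measure _"] simp: space_pair_measure measurable_pair_swap')
  finally show ?thesis .
qed

lemma joint_excess_commute:
  assumes "real_distribution A" "real_distribution B"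
  shows "joint_excess h A B x = joint_excess h B A x"
proof -
  have "joint_excess h A B x = measure (A \<Otimes>\<^sub>M B) {z. h < fst z \<and> h < snd z \<and> x < fst z + snd z}"
    by (simp add: joint_excess_def case_prod_unfold)
  also have "\<dots> = measure (B \<Otimes>\<^sub>M A) {(v, u). h < u \<and> h < v \<and> x < u + v}"
    by (subst measure_pair_swap[OF assms joint_excess_event_sets]) simp
  also have "\<dots> = joint_excess h B A x"
    unfolding joint_excess_def by (intro arg_cong[where f = "measure _"]) auto
  finally show ?thesis .
qed

text \<open>Both summands cannot be at most \<open>h\<close> when their sum exceeds \<open>2 * h\<close>; this makes the events
  disjoint. The event that the second summand is small is the event \<open>small_first\<close> with the roles of
  \<open>A\<close> and \<open>B\<close> exchanged.\<close>

lemma tail_convolution_split: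
  assumes "real_distribution A" "real_distribution B" "x \<ge> 2 * h"
  shows "tail (A \<star> B) x = small_first h A B x + small_first h B A x + joint_excess h A B x"
proof -
  interpret A: real_distribution A by fact
  interpret B: real_distribution B by fact
  interpret P: pair_prob_space A B ..
  let ?S1 = "{z::real \<times> real. fst z \<le> h \<and> x < fst z + snd z}"
  let ?S2 = "{z::real \<times> real. snd z \<le> h \<and> x < fst z + snd z}"
  let ?R = "{z::real \<times> real. h < fst z \<and> h < snd z \<and> x < fst z + snd z}"
  have sets: "?S1 \<in> sets (A \<Otimes>\<^sub>M B)" "?S2 \<in> sets (A \<Otimes>\<^sub>M B)" "?R \<in> sets (A \<Otimes>\<^sub>M B)"
    unfolding sets_pair_real_distributions[OF assms(1,2)]
    by (fact small_first_event_sets small_second_event_sets joint_excess_event_sets)+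
  have "tail (A \<star> B) x = measure (A \<Otimes>\<^sub>M B) {z. x < fst z + snd z}"
    unfolding tail_def convolution_def
    by (subst measure_distr)
      (auto intro!: arg_cong[where f = "measure _"] simp: space_pair_measure)
  also have "{z. x < fst z + snd z} = (?S1 \<union> ?S2) \<union> ?R" by auto
  also have "measure (A \<Otimes>\<^sub>M B) \<dots> = measure (A \<Otimes>\<^sub>M B) (?S1 \<union> ?S2) + measure (A \<Otimes>\<^sub>M B) ?R"
    using sets by (intro P.finite_measure_Union) auto
  also have "measure (A \<Otimes>\<^sub>M B) (?S1 \<union> ?S2) = measure (A \<Otimes>\<^sub>M B) ?S1 + measure (A \<Otimes>\<^sub>M B) ?S2"
    using sets assms(3) by (intro P.finite_measure_Union) auto
  also have "measure (A \<Otimes>\<^sub>M B) ?S2 = small_first h B A x"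
    unfolding small_first_def
    by (subst measure_pair_swap[OF assms(1,2) small_second_event_sets])
      (auto intro!: arg_cong[where f = "measure _"])
  finally show ?thesis
    by (simp add: small_first_def joint_excess_def case_prod_unfold)
qed

text \<open>The lower bound comes from the rectangle where \<open>-h < u \<le> h\<close> and \<open>v > x + h\<close>, the upper bound
  from the half-plane \<open>v > x - h\<close>, which is forced by \<open>u \<le> h\<close> and \<open>u + v > x\<close>.\<close>

lemma small_first_bounds:
  assumes "real_distribution A" "real_distribution B"
  shows "measure A {-h<..h} * tail B (x + h) \<le> small_first h A B x"
    and "small_first h A B x \<le> tail B (x - h)"
proof -
  interpret A: real_distribution A by fact
  interpret B: real_distribution B by fact
  interpret P: pair_prob_space A B ..
  have meas: "{(u, v). u \<le> h \<and> x < u + v} \<in> sets (A \<Otimes>\<^sub>M B)"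
    using small_first_event_sets
    by (simp add: sets_pair_real_distributions[OF assms] case_prod_unfold)
  have "measure A {-h<..h} * tail B (x + h) = measure (A \<Otimes>\<^sub>M B) ({-h<..h} \<times> {x + h<..})"
    unfolding tail_def by (simp add: measure_pair_Times[OF assms])
  also have "\<dots> \<le> small_first h A B x"
    unfolding small_first_def using meas by (intro P.finite_measure_mono) auto
  finally show "measure A {-h<..h} * tail B (x + h) \<le> small_first h A B x" .
  have "small_first h A B x \<le> measure (A \<Otimes>\<^sub>M B) (UNIV \<times> {x - h<..})"
    unfolding small_first_def
    by (intro P.finite_measure_mono) (auto simp: sets_pair_real_distributions[OF assms])
  also have "\<dots> = tail B (x - h)"
    using A.prob_space by (simp add: tail_def measure_pair_Times[OF assms])
  finally show "small_first h A B x \<le> tail B (x - h)" .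
qed

text \<open>There are two sources of error in the bounds above: the increment of \<open>tail B\<close> between \<open>x - h\<close> and
  \<open>x + h\<close>, which is \<open>o(tail F)\<close> for fixed \<open>h\<close>, and the mass of \<open>A\<close> outside \<open>{-h<..h}\<close>,
  multiplied by \<open>tail B\<close>, which is small only after \<open>h\<close> has been chosen large. This is why the level
  is quantified outside the argument \<open>x\<close> here and in all that follows.\<close>

lemma small_first_asymp:
  assumes "tail_regular F A" "tail_regular F B" "\<epsilon> > 0"
  shows "\<forall>\<^sub>F h in at_top. \<forall>\<^sub>F x in at_top. \<bar>small_first h A B x - tail B x\<bar> \<le> \<epsilon> * tail F x"
proof -
  have A: "real_distribution A" and B: "real_distribution B"
    and big: "tail B \<in> O[at_top](tail F)"
    using assms by (auto simp: tail_regular_def)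
  obtain c where c: "c > 0" "\<forall>\<^sub>F x in at_top. norm (tail B x) \<le> c * norm (tail F x)"
    using landau_o.bigE[OF big] by blast
  \<comment> \<open>The lost mass is multiplied by \<open>tail B\<close>, hence by at most \<open>c * tail F\<close>; half of \<open>\<epsilon>\<close> is
    reserved for it and half for the increment.\<close>
  have "1 - \<epsilon> / (2 * c) < 1" using assms(3) c(1) by simp
  then have "\<forall>\<^sub>F h in at_top. measure A {-h<..h} > 1 - \<epsilon> / (2 * c)"
    using order_tendstoD(1)[OF measure_symmetric_Ioc_tendsto_1[OF A]] by blast
  with eventually_ge_at_top[of 0] show ?thesis
  proof eventually_elim
    case (elim h)
    have "\<forall>\<^sub>F x in at_top. tail B (x - h) - tail B (x + h) \<le> \<epsilon> / 2 * tail F x"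
      using assms by (intro tail_regular_eventually_small_window) auto
    with c(2) show ?case
    proof eventually_elim
      case (elim x)
      let ?w = "measure A {-h<..h}"
      have mono: "tail B (x + h) \<le> tail B x" "tail B x \<le> tail B (x - h)"
        using \<open>0 \<le> h\<close> by (auto intro!: tail_antimono[OF B])
      have "(1 - ?w) * tail B (x + h) \<le> \<epsilon> / (2 * c) * (c * tail F x)"
        using elim mono \<open>?w > _\<close> assms(3) c(1) by (intro mult_mono) auto
      also have "\<dots> = \<epsilon> / 2 * tail F x" using c(1) by simp
      finally have "tail B (x + h) - ?w * tail B (x + h) \<le> \<epsilon> / 2 * tail F x"
        by (simp add: algebra_simps)
      moreover have "\<epsilon> * tail F x = \<epsilon> / 2 * tail F x + \<epsilon> / 2 * tail F x" by simp
      moreover have "0 \<le> \<epsilon> / 2 * tail F x" using assms(3) by simp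
      ultimately show ?case
        using small_first_bounds[OF A B, of h x] elim mono by linarith
    qed
  qed
qed

lemma tail_convolution_remainder:
  assumes "tail_regular F A" "tail_regular F B" "\<epsilon> > 0"
  shows "\<forall>\<^sub>F h in at_top. \<forall>\<^sub>F x in at_top.
    \<bar>tail (A \<star> B) x - (tail A x + tail B x) - joint_excess h A B x\<bar> \<le> \<epsilon> * tail F x"
proof -
  have A: "real_distribution A" and B: "real_distribution B"
    using assms by (auto simp: tail_regular_def)
  have "\<epsilon> / 2 > 0" using assms by simp
  from small_first_asymp[OF assms(1,2) this] small_first_asymp[OF assms(2,1) this]
  show ?thesis
  proof eventually_elim
    case (elim h)
    then show ?case using eventually_ge_at_top[of "2 * h"]
    proof eventually_elim
      case (elim x)
      have "\<epsilon> * tail F x = \<epsilon> / 2 * tail F x + \<epsilon> / 2 * tail F x" by simp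
      with elim tail_convolution_split[OF A B, of h x] show ?case by linarith
    qed
  qed
qed

section \<open>Two simultaneous large summands\<close>

text \<open>Condition on the first summand \<open>u > h\<close>: the second must then exceed \<open>max h (x - u)\<close>, a threshold
  that is at least \<open>h\<close>, where the domination of \<open>tail B\<close> by \<open>tail F\<close> is available. Without the
  restriction \<open>h < v\<close> in the event, the threshold would be unbounded below.\<close>

lemma joint_excess_mono:
  assumes "real_distribution A" "real_distribution B" "real_distribution F"
    and "c \<ge> 0" "\<And>y. y \<ge> h \<Longrightarrow> tail B y \<le> c * tail F y"
  shows "joint_excess h A B x \<le> c * joint_excess h A F x"
proof -
  interpret A: real_distribution A by fact
  interpret B: real_distribution B by fact
  interpret F: real_distribution F by fact
  interpret AB: pair_prob_space A B ..
  interpret AF: pair_prob_space A F ..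
  let ?R = "{(u, v). h < u \<and> h < v \<and> x < u + v}"
  have RB: "?R \<in> sets (A \<Otimes>\<^sub>M B)" and RF: "?R \<in> sets (A \<Otimes>\<^sub>M F)"
    using joint_excess_event_sets
    by (simp_all add: sets_pair_real_distributions assms case_prod_unfold)
  have section_le: "emeasure B (Pair u -` ?R) \<le> ennreal c * emeasure F (Pair u -` ?R)" for u
  proof (cases "h < u")
    case True
    then have "Pair u -` ?R = {max h (x - u)<..}" by auto
    then show ?thesis
      using assms(5)[of "max h (x - u)"] assms(4)
      by (simp add: B.emeasure_eq_measure F.emeasure_eq_measure tail_def
          flip: ennreal_mult)
  next
    case False
    then have empty: "Pair u -` ?R = {}" by auto
    show ?thesis unfolding empty by simp
  qed
  have "emeasure (A \<Otimes>\<^sub>M B) ?R = (\<integral>\<^sup>+ u. emeasure B (Pair u -` ?R) \<partial>A)"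
    by (rule B.emeasure_pair_measure_alt[OF RB])
  also have "\<dots> \<le> (\<integral>\<^sup>+ u. ennreal c * emeasure F (Pair u -` ?R) \<partial>A)"
    by (intro nn_integral_mono section_le)
  also have "\<dots> = ennreal c * (\<integral>\<^sup>+ u. emeasure F (Pair u -` ?R) \<partial>A)"
    by (intro nn_integral_cmult F.measurable_emeasure_Pair RF)
  also have "(\<integral>\<^sup>+ u. emeasure F (Pair u -` ?R) \<partial>A) = emeasure (A \<Otimes>\<^sub>M F) ?R"
    by (rule F.emeasure_pair_measure_alt[OF RF, symmetric])
  finally show ?thesis
    using assms(4)
    by (simp add: joint_excess_def AB.emeasure_eq_measure AF.emeasure_eq_measure
        flip: ennreal_mult)
qed

text \<open>For two copies of \<open>F\<close> the joint excess is, up to a small multiple of \<open>tail F\<close>, what remains of the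
  tail of \<open>F \<star> F\<close> after subtraction of \<open>2 * tail F\<close>, which is negligible by subexponentiality.\<close>

lemma subexponential_joint_excess:
  assumes "subexponential F" "\<epsilon> > 0"
  shows "\<forall>\<^sub>F h in at_top. \<forall>\<^sub>F x in at_top. joint_excess h F F x \<le> \<epsilon> * tail F x"
proof -
  have F: "tail_regular F F" and conv: "(\<lambda>x. tail (F \<star> F) x - 2 * tail F x) \<in> o[at_top](tail F)"
    using assms by (auto simp: subexponential_def intro: tail_regular_refl)
  have half: "\<epsilon> / 2 > 0" using assms by simp
  from tail_convolution_remainder[OF F F half]
  show ?thesis
  proof eventually_elim
    case (elim h)
    from elim landau_o.smallD[OF conv half] show ?case
    proof eventually_elim
      case (elim x)
      have "\<epsilon> * tail F x = \<epsilon> / 2 * tail F x + \<epsilon> / 2 * tail F x" by simp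
      with elim show ?case
        unfolding real_norm_def abs_of_nonneg[OF tail_nonneg] by linarith
    qed
  qed
qed

text \<open>Replacing \<open>B\<close> and then \<open>A\<close> by \<open>F\<close> costs the product of the two domination constants; since
  domination is used in the second factor only, the factors are exchanged in between.\<close>

lemma tail_regular_joint_excess:
  assumes "subexponential F" "tail_regular F A" "tail_regular F B" "\<epsilon> > 0"
  shows "\<forall>\<^sub>F h in at_top. \<forall>\<^sub>F x in at_top. joint_excess h A B x \<le> \<epsilon> * tail F x"
proof -
  have A: "real_distribution A" and B: "real_distribution B" and F: "real_distribution F"
    using assms by (auto simp: tail_regular_def subexponential_def)
  have dom: "\<exists>c>0. \<forall>\<^sub>F h in at_top. \<forall>y\<ge>h. tail D y \<le> c * tail F y" if D: "tail_regular F D" for D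
  proof -
    have "tail D \<in> O[at_top](tail F)" using D by (simp add: tail_regular_def)
    from landau_o.bigE[OF this]
    obtain c where c: "c > 0" "\<forall>\<^sub>F x in at_top. norm (tail D x) \<le> c * norm (tail F x)"
      by blast
    from eventually_all_ge_at_top[OF c(2)]
    have "\<forall>\<^sub>F h in at_top. \<forall>y\<ge>h. tail D y \<le> c * tail F y" by simp
    with c(1) show ?thesis by blast
  qed
  obtain a where a: "a > 0" "\<forall>\<^sub>F h in at_top. \<forall>y\<ge>h. tail A y \<le> a * tail F y"
    using dom[OF assms(2)] by blast
  obtain b where b: "b > 0" "\<forall>\<^sub>F h in at_top. \<forall>y\<ge>h. tail B y \<le> b * tail F y"
    using dom[OF assms(3)] by blast
  have "\<epsilon> / (a * b) > 0" using assms(4) a(1) b(1) by simp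
  from subexponential_joint_excess[OF assms(1) this] a(2) b(2) show ?thesis
  proof eventually_elim
    case (elim h)
    from elim(1) show ?case
    proof eventually_elim
      case (elim x)
      have "joint_excess h A B x \<le> b * joint_excess h A F x"
        using b(1) \<open>\<forall>y\<ge>h. tail B y \<le> _\<close> by (intro joint_excess_mono[OF A B F]) simp_all
      also have "joint_excess h A F x = joint_excess h F A x"
        by (rule joint_excess_commute[OF A F])
      also have "\<dots> \<le> a * joint_excess h F F x"
        using a(1) \<open>\<forall>y\<ge>h. tail A y \<le> _\<close> by (intro joint_excess_mono[OF F A F]) simp_all
      also have "\<dots> \<le> a * (\<epsilon> / (a * b) * tail F x)"
        using elim a(1) by (intro mult_left_mono) simp_all
      finally have "joint_excess h A B x \<le> b * (a * (\<epsilon> / (a * b) * tail F x))"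
        using b(1) by simp
      then show ?case using a(1) b(1) by simp
    qed
  qed
qed

section \<open>Convolutions of regular tails\<close>

lemma tail_convolution_asymp:
  assumes "subexponential F" "tail_regular F A" "tail_regular F B"
  shows "(\<lambda>x. tail (A \<star> B) x - (tail A x + tail B x)) \<in> o[at_top](tail F)"
proof (rule landau_o.smallI)
  fix \<epsilon> :: real assume "\<epsilon> > 0"
  then have half: "\<epsilon> / 2 > 0" by simp
  have "\<forall>\<^sub>F h :: real in at_top. \<forall>\<^sub>F x in at_top.
    norm (tail (A \<star> B) x - (tail A x + tail B x)) \<le> \<epsilon> * norm (tail F x)"
    using tail_convolution_remainder[OF assms(2,3) half] tail_regular_joint_excess[OF assms half]
  proof eventually_elim
    case (elim h)
    then show ?case
    proof eventually_elim
      case (elim x)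
      have "\<epsilon> * tail F x = \<epsilon> / 2 * tail F x + \<epsilon> / 2 * tail F x" by simp
      moreover have "joint_excess h A B x \<ge> 0" by (simp add: joint_excess_def)
      ultimately show ?case
        using elim unfolding real_norm_def abs_of_nonneg[OF tail_nonneg] by linarith
    qed
  qed
  then show "\<forall>\<^sub>F x in at_top.
    norm (tail (A \<star> B) x - (tail A x + tail B x)) \<le> \<epsilon> * norm (tail F x)"
    by simp
qed

text \<open>The increment of the tail of \<open>A \<star> B\<close> is the sum of the increments for \<open>A\<close> and \<open>B\<close> and of the
  increment of the remainder in \<open>tail_convolution_asymp\<close>. The shifted remainder is a priori only
  \<open>o\<close> of the shifted tail of \<open>F\<close>, which is \<open>O(tail F)\<close> because \<open>F\<close> is long-tailed.\<close>

lemma tail_regular_convolution: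
  assumes "subexponential F" "tail_regular F A" "tail_regular F B"
  shows "tail_regular F (A \<star> B)"
proof -
  have A: "real_distribution A" "tail A \<in> O[at_top](tail F)"
      "\<And>a. (\<lambda>x. tail A (x + a) - tail A x) \<in> o[at_top](tail F)"
    and B: "real_distribution B" "tail B \<in> O[at_top](tail F)"
      "\<And>a. (\<lambda>x. tail B (x + a) - tail B x) \<in> o[at_top](tail F)"
    using assms by (auto simp: tail_regular_def)
  let ?r = "\<lambda>x. tail (A \<star> B) x - (tail A x + tail B x)"
  have r: "?r \<in> o[at_top](tail F)" by (rule tail_convolution_asymp[OF assms])
  have "(\<lambda>x. ?r x + (tail A x + tail B x)) \<in> O[at_top](tail F)"
    by (rule sum_in_bigo(1)[OF landau_o.small_imp_big[OF r] sum_in_bigo(1)[OF A(2) B(2)]])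
  then have big: "tail (A \<star> B) \<in> O[at_top](tail F)" by simp
  have "(\<lambda>x. tail (A \<star> B) (x + a) - tail (A \<star> B) x) \<in> o[at_top](tail F)" for a
  proof -
    have "filterlim (\<lambda>x::real. x + a) at_top at_top"
      using filterlim_tendsto_add_at_top[OF tendsto_const[of a] filterlim_ident]
      by (simp add: add.commute)
    from landau_o.small.compose[OF r this]
    have "(\<lambda>x. ?r (x + a)) \<in> o[at_top](\<lambda>x. tail F (x + a))" .
    moreover have "(\<lambda>x. tail F (x + a)) \<in> O[at_top](tail F)"
    proof -
      have "(\<lambda>x. (tail F (x + a) - tail F x) + tail F x) \<in> O[at_top](tail F)"
        using assms(1)
        by (intro sum_in_bigo landau_o.small_imp_big[OF long_tailed_increment])
          (auto simp: subexponential_def)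
      then show ?thesis by simp
    qed
    ultimately have "(\<lambda>x. ?r (x + a)) \<in> o[at_top](tail F)"
      by (rule landau_o.small_big_trans)
    from sum_in_smallo(1)[OF sum_in_smallo(2)[OF this r] sum_in_smallo(1)[OF A(3) B(3)]]
    have "(\<lambda>x. (?r (x + a) - ?r x) + ((tail A (x + a) - tail A x) + (tail B (x + a) - tail B x)))
        \<in> o[at_top](tail F)" .
    then show ?thesis by (simp add: algebra_simps)
  qed
  with big real_distribution_convolution[OF A(1) B(1)] show ?thesis
    by (simp add: tail_regular_def)
qed

lemma tail_return_0: "tail (return borel 0) x = (if x < 0 then 1 else 0)"
  by (simp add: tail_def measure_return)

lemma tail_regular_return_0: "tail_regular F (return borel 0)"
proof -
  have "real_distribution (return borel (0::real))"
    by (simp add: real_distribution_def real_distribution_axioms_def prob_space_return)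
  moreover have "tail (return borel 0) \<in> O[at_top](tail F)"
    by (intro bigoI[of _ 0] eventually_mono[OF eventually_ge_at_top[of 0]])
      (simp add: tail_return_0)
  moreover have "(\<lambda>x. tail (return borel 0) (x + a) - tail (return borel 0) x) \<in> o[at_top](tail F)" for a
    by (intro landau_o.smallI eventually_mono[OF eventually_ge_at_top[of "max 0 (-a)"]])
      (simp add: tail_return_0)
  ultimately show ?thesis by (simp add: tail_regular_def)
qed

text \<open>Regularity of the partial convolution is carried along, since the step applies the result for two
  factors to it. The induction starts at the empty convolution, whose tail vanishes on the positive
  half-line.\<close>

lemma tail_convolutions_asymp:
  assumes "subexponential F" "\<And>k. k \<in> {1..n} \<Longrightarrow> tail_regular F (G k)"
  shows "tail_regular F (convolutions G n) \<and>
    (\<lambda>x. tail (convolutions G n) x - (\<Sum>i=1..n. tail (G i) x)) \<in> o[at_top](tail F)"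
  using assms(2)
proof (induction n)
  case 0
  have "tail (return borel 0) \<in> o[at_top](tail F)"
    by (intro landau_o.smallI eventually_mono[OF eventually_ge_at_top[of 0]])
      (simp add: tail_return_0)
  then show ?case by (simp add: tail_regular_return_0)
next
  case (Suc n)
  let ?C = "convolutions G n" and ?H = "G (Suc n)"
  have C: "tail_regular F ?C"
    and sum: "(\<lambda>x. tail ?C x - (\<Sum>i=1..n. tail (G i) x)) \<in> o[at_top](tail F)"
    and H: "tail_regular F ?H"
    using Suc by auto
  have "(\<lambda>x. (tail (?C \<star> ?H) x - (tail ?C x + tail ?H x)) +
      (tail ?C x - (\<Sum>i=1..n. tail (G i) x))) \<in> o[at_top](tail F)"
    by (rule sum_in_smallo(1)[OF tail_convolution_asymp[OF assms(1) C H] sum])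
  then show ?case
    using tail_regular_convolution[OF assms(1) C H] by (simp add: algebra_simps)
qed

theorem theorem15:
  fixes F :: "real measure" and G :: "nat \<Rightarrow> real measure" and n :: nat
  assumes "n \<ge> 1"
    and "subexponential F"
    and "\<And>k. k \<in> {1..n} \<Longrightarrow> real_distribution (G k)"
    and "\<And>k. k \<in> {1..n} \<Longrightarrow> long_tailed (add_measure F (G k))"
    and "\<And>k. k \<in> {1..n} \<Longrightarrow> tail (G k) \<in> O[at_top](tail F)"
  shows "(\<lambda>x. tail (convolutions G n) x - (\<Sum>i=1..n. tail (G i) x)) \<in> o[at_top](tail F)"
proof -
  have "tail_regular F (G k)" if "k \<in> {1..n}" for k
    using assms(2) assms(3-5)[OF that]
    by (intro tail_regular_of_long_tailed_sum) (auto simp: subexponential_def)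
  with assms(2) show ?thesis
    using tail_convolutions_asymp by blast
qed

end
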